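(* Let $p>3$ be a prime. Then $$\sum_{k=0}^{p-1}\binom{-1/(p+1)}{k}^{p+1}\equiv 0 \pmod{p^5}.$$
   Context: For a rational number $x$ and a nonnegative integer $k$, $\binom{x}{k}=\frac{x(x-1)\cdots(x-k+1)}{k!}$ (with $\binom{x}{0}=1$). For rationals $a,b$ whose denominators are prime to $p$, $a\equiv b \pmod{p^r}$ means that $(a-b)/p^r$ is a rational number whose denominator is prime to $p$ (i.e. a $p$-adic integer). *)

theory Defs
  imports Complex_Main "HOL-Computational_Algebra.Primes"
begin

(* quotient_of returns the fraction in lowest terms with positive denominator. *)
definition p_integral :: "nat \<Rightarrow> rat \<Rightarrow> bool" where
  "p_integral p x \<longleftrightarrow> coprime (snd (quotient_of x)) (int p)"

(* The congruence a = b (mod p^r) on the rationals with denominator prime to p;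
   it is false when a or b lies outside that ring. *)
definition rat_cong_pow :: "nat \<Rightarrow> nat \<Rightarrow> rat \<Rightarrow> rat \<Rightarrow> bool" where
  "rat_cong_pow p r a b \<longleftrightarrow>
     p_integral p a \<and> p_integral p b \<and> p_integral p ((a - b) / of_nat p ^ r)"

end

theory Submission
  imports Defs
begin

text \<open>
  Put \<open>t = p / (p + 1)\<close>, so that \<open>-1 / (p + 1) = t - 1\<close> and the \<open>k\<close>-th summand is
  \<open>\<Prod>j\<le>k. (1 - t / j)^(p + 1)\<close>. Since \<open>(p + 1) * t = p\<close> and \<open>p dvd (p + 1 choose 4)\<close>, the binomial
  theorem gives modulo \<open>p^5\<close>
  \<open>(1 - t / j)^(p + 1) = (1 - p / j) * (1 + a / j^2 + b / j^3)\<close> with \<open>p^3 dvd a\<close> and \<open>p^4 dvd b\<close>.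
  Hence the summand is congruent to \<open>(-1)^k * (p - 1 choose k) * (1 + a * H\<^sub>2(k) + b * H\<^sub>3(k))\<close>
  with the generalized harmonic numbers \<open>H\<^sub>s(k)\<close>. Summed over \<open>k\<close>, the constant term vanishes,
  the \<open>a\<close>-term becomes \<open>-a * H\<^sub>1(p - 1) / (p - 1)\<close>, which is divisible by \<open>p^3 * p^2\<close> by
  Wolstenholme's theorem, and the \<open>b\<close>-term becomes a multiple of
  \<open>b * (H\<^sub>1(p - 1)^2 + H\<^sub>2(p - 1))\<close>, which is divisible by \<open>p^4 * p\<close>.
\<close>

section \<open>The ring of p-integral rationals and divisibility by powers of p\<close>

text \<open>If \<open>c / d\<close> is in lowest terms and equals \<open>a / b\<close>, then
  \<open>d\<close> divides \<open>b\<close>, so \<open>d\<close> inherits coprimality to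
  \<open>p\<close>. Closure proofs can thus work with unreduced fractions.\<close>

lemma p_integral_iff:
  assumes "prime p"
  shows "p_integral p x \<longleftrightarrow> (\<exists>a b. coprime b (int p) \<and> x = of_int a / of_int b)"
proof
  obtain c d where cd: "quotient_of x = (c, d)"
    by (cases "quotient_of x")
  have d: "d > 0" "coprime c d" "x = of_int c / of_int d"
    using quotient_of_denom_pos[OF cd] quotient_of_coprime[OF cd] quotient_of_div[OF cd] by auto
  show "\<exists>a b. coprime b (int p) \<and> x = of_int a / of_int b" if "p_integral p x"
    using that cd d(3) unfolding p_integral_def by auto
  show "p_integral p x" if "\<exists>a b. coprime b (int p) \<and> x = of_int a / of_int b"
  proof -
    from that obtain a b where ab: "coprime b (int p)" "x = of_int a / of_int b"
      by blast
    have "b \<noteq> 0"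
      using ab(1) assms by (auto dest: prime_gt_1_nat)
    then have "(of_int (c * b) :: rat) = of_int (a * d)"
      using ab(2) d by (simp add: field_simps)
    then have "c * b = a * d"
      by (simp only: of_int_eq_iff)
    then have "d dvd c * b"
      by simp
    then have "d dvd b"
      using d(2) by (simp add: coprime_dvd_mult_right_iff coprime_commute)
    then show ?thesis
      using coprime_divisors[OF _ dvd_refl ab(1)] cd unfolding p_integral_def by simp
  qed
qed

text \<open>Divisibility by \<open>p ^ r\<close> inside the ring of p-integral rationals.
  Congruences modulo \<open>p ^ r\<close> are expressed below by applying it to a
  difference.\<close>

definition p_power_dvd :: "nat \<Rightarrow> nat \<Rightarrow> rat \<Rightarrow> bool" where
  "p_power_dvd p r x \<longleftrightarrow> (\<exists>y. p_integral p y \<and> x = of_nat p ^ r * y)"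

context
  fixes p :: nat
  assumes prime: "prime p"
begin

lemma p_integral_of_int [simp]: "p_integral p (of_int a)"
  unfolding p_integral_def by simp

lemma p_integral_of_nat [simp]: "p_integral p (of_nat n)"
  using p_integral_of_int[of "int n"] by simp

lemma p_integral_numeral [simp]:
  "p_integral p 0" "p_integral p 1" "p_integral p (numeral n)"
  using p_integral_of_nat[of 0] p_integral_of_nat[of 1] p_integral_of_nat[of "numeral n"] by simp_all

lemma p_integral_add:
  assumes "p_integral p x" "p_integral p y"
  shows "p_integral p (x + y)"
proof -
  obtain a b c d where *: "coprime b (int p)" "x = of_int a / of_int b"
      "coprime d (int p)" "y = of_int c / of_int d"
    using assms unfolding p_integral_iff[OF prime] by blast
  have "b \<noteq> 0" "d \<noteq> 0"
    using *(1,3) prime by (auto dest: prime_gt_1_nat)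
  then have "x + y = of_int (a * d + c * b) / of_int (b * d)"
    using *(2,4) by (simp add: field_simps)
  moreover have "coprime (b * d) (int p)"
    using * by simp
  ultimately show ?thesis
    unfolding p_integral_iff[OF prime] by blast
qed

lemma p_integral_mult:
  assumes "p_integral p x" "p_integral p y"
  shows "p_integral p (x * y)"
proof -
  obtain a b c d where *: "coprime b (int p)" "x = of_int a / of_int b"
      "coprime d (int p)" "y = of_int c / of_int d"
    using assms unfolding p_integral_iff[OF prime] by blast
  have "x * y = of_int (a * c) / of_int (b * d)"
    using *(2,4) by simp
  moreover have "coprime (b * d) (int p)"
    using * by simp
  ultimately show ?thesis
    unfolding p_integral_iff[OF prime] by blast
qed

lemma p_integral_minus:
  assumes "p_integral p x"
  shows "p_integral p (- x)"
  using p_integral_mult[OF p_integral_of_int[of "- 1"] assms] by simp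

lemma p_integral_diff: "p_integral p x \<Longrightarrow> p_integral p y \<Longrightarrow> p_integral p (x - y)"
  using p_integral_add[of x "- y"] p_integral_minus[of y] by simp

lemma p_integral_power: "p_integral p x \<Longrightarrow> p_integral p (x ^ n)"
  by (induction n) (simp_all add: p_integral_mult)

lemma p_integral_sum: "(\<And>i. i \<in> A \<Longrightarrow> p_integral p (f i)) \<Longrightarrow> p_integral p (sum f A)"
  by (induction A rule: infinite_finite_induct) (simp_all add: p_integral_add)

lemma p_integral_inverse_of_nat:
  assumes "\<not> p dvd n"
  shows "p_integral p (1 / of_nat n)"
proof -
  have "coprime (int n) (int p)"
    using prime_imp_coprime[OF prime assms] by (simp add: coprime_commute)
  moreover have "(1 :: rat) / of_nat n = of_int 1 / of_int (int n)"
    by simp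
  ultimately show ?thesis
    unfolding p_integral_iff[OF prime] by blast
qed

lemma p_integral_inverse_less: "0 < j \<Longrightarrow> j < p \<Longrightarrow> p_integral p (1 / of_nat j)"
  by (intro p_integral_inverse_of_nat) (auto dest: dvd_imp_le)

lemma p_power_dvd_iff: "p_power_dvd p r x \<longleftrightarrow> p_integral p (x / of_nat p ^ r)"
proof
  show "p_integral p (x / of_nat p ^ r)" if "p_power_dvd p r x"
    using that prime_gt_0_nat[OF prime] unfolding p_power_dvd_def by force
  show "p_power_dvd p r x" if "p_integral p (x / of_nat p ^ r)"
    unfolding p_power_dvd_def
    using that prime_gt_0_nat[OF prime] by (intro exI[of _ "x / of_nat p ^ r"]) simp
qed

lemma p_power_dvd_0 [simp]: "p_power_dvd p r 0"
  unfolding p_power_dvd_iff by simp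

lemma p_power_dvd_add: "p_power_dvd p r x \<Longrightarrow> p_power_dvd p r y \<Longrightarrow> p_power_dvd p r (x + y)"
  unfolding p_power_dvd_iff add_divide_distrib by (rule p_integral_add)

lemma p_power_dvd_diff: "p_power_dvd p r x \<Longrightarrow> p_power_dvd p r y \<Longrightarrow> p_power_dvd p r (x - y)"
  unfolding p_power_dvd_iff diff_divide_distrib by (rule p_integral_diff)

lemma p_power_dvd_minus: "p_power_dvd p r x \<Longrightarrow> p_power_dvd p r (- x)"
  using p_power_dvd_diff[of r 0 x] by simp

lemma p_power_dvd_sum:
  "(\<And>i. i \<in> A \<Longrightarrow> p_power_dvd p r (f i)) \<Longrightarrow> p_power_dvd p r (sum f A)"
  unfolding p_power_dvd_iff sum_divide_distrib by (rule p_integral_sum)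

lemma p_power_dvd_mult:
  assumes "p_power_dvd p r x" "p_power_dvd p s y"
  shows "p_power_dvd p (r + s) (x * y)"
  using p_integral_mult[OF assms[unfolded p_power_dvd_iff]]
  unfolding p_power_dvd_iff by (simp add: power_add)

lemma p_power_dvd_zero_iff: "p_power_dvd p 0 x \<longleftrightarrow> p_integral p x"
  unfolding p_power_dvd_iff by simp

lemma p_power_dvd_mult_left: "p_integral p x \<Longrightarrow> p_power_dvd p r y \<Longrightarrow> p_power_dvd p r (x * y)"
  using p_power_dvd_mult[of 0 x r y] by (simp add: p_power_dvd_zero_iff)

lemma p_power_dvd_mult_right: "p_power_dvd p r x \<Longrightarrow> p_integral p y \<Longrightarrow> p_power_dvd p r (x * y)"
  using p_power_dvd_mult_left[of y r x] by (simp add: mult.commute)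

lemma p_power_dvd_power_mult: "p_integral p y \<Longrightarrow> p_power_dvd p r (of_nat p ^ r * y)"
  unfolding p_power_dvd_def by blast

lemma p_power_dvd_mono:
  assumes "p_power_dvd p s x" "r \<le> s"
  shows "p_power_dvd p r x"
proof -
  obtain y where y: "p_integral p y" "x = of_nat p ^ s * y"
    using assms(1) unfolding p_power_dvd_def by blast
  have "x = of_nat p ^ r * (of_nat p ^ (s - r) * y)"
    using y(2) assms(2) by (simp flip: power_add mult.assoc)
  moreover have "p_integral p (of_nat p ^ (s - r) * y)"
    using y(1) by (simp add: p_integral_mult p_integral_power)
  ultimately show ?thesis
    unfolding p_power_dvd_def by blast
qed

lemma p_power_dvd_power: "p_power_dvd p 1 x \<Longrightarrow> p_power_dvd p r (x ^ r)"
proof (induction r)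
  case (Suc r)
  then show ?case
    using p_power_dvd_mult[of 1 x r "x ^ r"] by simp
qed (simp add: p_power_dvd_zero_iff)

lemma p_power_dvd_trans_diff:
  "p_power_dvd p r (x - y) \<Longrightarrow> p_power_dvd p r (y - z) \<Longrightarrow> p_power_dvd p r (x - z)"
  using p_power_dvd_add[of r "x - y" "y - z"] by simp

text \<open>Congruences multiply: the difference of products splits as
  \<open>(x - x') * y + x' * (y - y')\<close>, which is why integrality is asked of
  \<open>x'\<close> and \<open>y\<close>.\<close>

lemma p_power_dvd_diff_mult:
  assumes "p_power_dvd p r (x - x')" "p_power_dvd p r (y - y')" "p_integral p x'" "p_integral p y"
  shows "p_power_dvd p r (x * y - x' * y')"
proof -
  have "x * y - x' * y' = (x - x') * y + x' * (y - y')"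
    by (simp add: algebra_simps)
  then show ?thesis
    using assms by (simp add: p_power_dvd_add p_power_dvd_mult_left p_power_dvd_mult_right)
qed

end

section \<open>Generalized harmonic numbers and alternating binomial sums\<close>

definition gen_harm :: "nat \<Rightarrow> nat \<Rightarrow> rat" where
  "gen_harm s n = (\<Sum>j = 1..n. 1 / of_nat j ^ s)"

definition alt_binomial_sum :: "nat \<Rightarrow> nat \<Rightarrow> rat" where
  "alt_binomial_sum s n = (\<Sum>j = 1..n. (-1) ^ j * of_nat (n choose j) / of_nat j ^ s)"

lemma gen_harm_Suc: "gen_harm s (Suc n) = gen_harm s n + 1 / of_nat (Suc n) ^ s"
  by (simp add: gen_harm_def)

text \<open>The full alternating row sum is 0, and \<open>alt_binomial_sum\<close> omits its term 1
  at \<open>j = 0\<close>.\<close>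

lemma alt_binomial_sum_0_Suc: "alt_binomial_sum 0 (Suc n) = - 1"
proof -
  have "0 = (\<Sum>j\<le>Suc n. (-1) ^ j * of_nat (Suc n choose j) :: rat)"
    by (rule choose_alternating_sum[symmetric]) simp
  also have "\<dots> = 1 + alt_binomial_sum 0 (Suc n)"
    unfolding alt_binomial_sum_def
    by (simp add: atMost_atLeast0 sum.atLeast_Suc_atMost del: sum.cl_ivl_Suc binomial_Suc_Suc)
  finally show ?thesis
    by simp
qed

lemma binomial_absorb_divide:
  "of_nat (n choose i) / of_nat (Suc i) = (of_nat (Suc n choose Suc i) / of_nat (Suc n) :: rat)"
proof -
  have "(of_nat (Suc i) :: rat) * of_nat (Suc n choose Suc i) = of_nat (Suc n) * of_nat (n choose i)"
    by (metis of_nat_mult Suc_times_binomial)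
  then show ?thesis
    by (simp add: divide_simps del: of_nat_Suc binomial_Suc_Suc) (simp add: mult_ac)
qed

text \<open>Pascal's rule splits \<open>Suc n choose j\<close>, and absorption turns
  \<open>(n choose (j - 1)) / j\<close> into \<open>(Suc n choose j) / Suc n\<close>, which lowers
  the exponent of \<open>j\<close> by one.\<close>

lemma alt_binomial_sum_Suc:
  "alt_binomial_sum (Suc s) (Suc n) =
     alt_binomial_sum (Suc s) n + alt_binomial_sum s (Suc n) / of_nat (Suc n)"
proof -
  have *: "(-1) ^ j * of_nat (Suc n choose j) / of_nat j ^ Suc s =
      (-1) ^ j * of_nat (n choose j) / of_nat j ^ Suc s +
      (-1) ^ j * of_nat (Suc n choose j) / of_nat j ^ s / (of_nat (Suc n) :: rat)"
    if j: "j \<in> {1..Suc n}" for j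
  proof -
    obtain i where i: "j = Suc i"
      using j by (cases j) auto
    have "(-1) ^ j * of_nat (Suc n choose j) / of_nat j ^ s / (of_nat (Suc n) :: rat) =
        (-1) ^ j / of_nat j ^ s * (of_nat (Suc n choose j) / of_nat (Suc n))"
      by simp
    also have "\<dots> = (-1) ^ j / of_nat j ^ s * (of_nat (n choose i) / of_nat j)"
      unfolding i binomial_absorb_divide ..
    finally have "(-1) ^ j * of_nat (Suc n choose j) / of_nat j ^ s / (of_nat (Suc n) :: rat) =
        (-1) ^ j * of_nat (n choose i) / of_nat j ^ Suc s"
      by simp
    moreover have "of_nat (Suc n choose j) = (of_nat (n choose j) + of_nat (n choose i) :: rat)"
      unfolding i by simp
    ultimately show ?thesis
      by (simp only: distrib_left add_divide_distrib)
  qed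
  have "alt_binomial_sum (Suc s) (Suc n) =
      (\<Sum>j = 1..Suc n. (-1) ^ j * of_nat (n choose j) / of_nat j ^ Suc s) +
      alt_binomial_sum s (Suc n) / of_nat (Suc n)"
    unfolding alt_binomial_sum_def
    by (simp only: * sum.distrib sum_divide_distrib cong: sum.cong)
  \<comment> \<open>The extra term at \<open>j = Suc n\<close> vanishes because
    \<open>n choose Suc n = 0\<close>.\<close>
  then show ?thesis
    by (simp add: alt_binomial_sum_def)
qed

lemma alt_binomial_sum_1: "alt_binomial_sum 1 n = - gen_harm 1 n"
proof (induction n)
  case 0
  then show ?case
    by (simp add: alt_binomial_sum_def gen_harm_def)
next
  case (Suc n)
  then show ?case
    using alt_binomial_sum_Suc[of 0 n] by (simp add: alt_binomial_sum_0_Suc gen_harm_Suc)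
qed

text \<open>By the recursion the left side changes by
  \<open>- 2 * gen_harm 1 (Suc n) / Suc n\<close> from \<open>n\<close> to \<open>Suc n\<close>.
  Expanding the square of \<open>gen_harm 1 (Suc n)\<close> gives the same change on the
  right.\<close>

lemma alt_binomial_sum_2: "2 * alt_binomial_sum 2 n = - (gen_harm 1 n ^ 2 + gen_harm 2 n)"
proof (induction n)
  case 0
  then show ?case
    by (simp add: alt_binomial_sum_def gen_harm_def)
next
  case (Suc n)
  have "2 * alt_binomial_sum 2 (Suc n) =
      2 * alt_binomial_sum 2 n - 2 * gen_harm 1 (Suc n) * (1 / of_nat (Suc n))"
    using alt_binomial_sum_Suc[of 1 n] alt_binomial_sum_1[of "Suc n"]
    by (simp add: numeral_2_eq_2)
  then show ?case
    unfolding Suc gen_harm_Suc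
    by (simp add: power2_eq_square algebra_simps del: of_nat_Suc)
qed

text \<open>Summation by parts, since \<open>(\<Sum>k\<le>m. (-1)^k * (n + 1 choose k)) = (-1)^m * (n choose m)\<close>.\<close>
lemma sum_alt_binomial_gen_harm:
  "(\<Sum>k\<le>Suc n. (-1) ^ k * of_nat (Suc n choose k) * gen_harm (Suc s) k) =
     alt_binomial_sum s (Suc n) / of_nat (Suc n)"
proof -
  let ?f = "\<lambda>j. (-1) ^ j * of_nat (n choose (j - 1)) / of_nat j ^ Suc s :: rat"
  have partial: "(\<Sum>k\<le>m. (-1) ^ k * of_nat (Suc n choose k) * gen_harm (Suc s) k) =
      (-1) ^ m * of_nat (n choose m) * gen_harm (Suc s) m + (\<Sum>j = 1..m. ?f j)" for m
  proof (induction m)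
    case 0
    then show ?case
      by (simp add: gen_harm_def)
  next
    case (Suc m)
    have "(\<Sum>j = 1..Suc m. ?f j) = (\<Sum>j = 1..m. ?f j) -
        (-1) ^ m * of_nat (n choose m) * (1 / of_nat (Suc m) ^ Suc s)"
      by simp
    then show ?case
      unfolding sum.atMost_Suc Suc gen_harm_Suc
      by (simp add: algebra_simps del: of_nat_Suc power_Suc)
        (simp add: algebra_simps del: of_nat_Suc)
  qed
  have "?f j = (-1) ^ j * of_nat (Suc n choose j) / of_nat j ^ s / of_nat (Suc n)"
    if j: "j \<in> {1..Suc n}" for j
  proof -
    obtain i where i: "j = Suc i"
      using j by (cases j) auto
    have "?f j = (-1) ^ j / of_nat j ^ s * (of_nat (n choose i) / of_nat (Suc i))"
      unfolding i by simp
    then show ?thesis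
      unfolding binomial_absorb_divide i by simp
  qed
  \<comment> \<open>At \<open>m = Suc n\<close> the boundary term of \<open>partial\<close> contains
    \<open>n choose Suc n = 0\<close>, so only the sum of \<open>?f\<close> survives.\<close>
  then show ?thesis
    unfolding partial alt_binomial_sum_def sum_divide_distrib by (simp add: binomial_eq_0)
qed


section \<open>Alternating binomial sums modulo p\<close>

lemma p_integral_gen_harm:
  assumes "prime p" "n < p"
  shows "p_integral p (gen_harm s n)"
proof -
  have "p_integral p (1 / of_nat j ^ s)" if "j \<in> {1..n}" for j
    using p_integral_power[OF assms(1) p_integral_inverse_less[OF assms(1), of j], of s] that assms(2)
    by (simp add: power_one_over)
  then show ?thesis
    unfolding gen_harm_def by (rule p_integral_sum[OF assms(1)])
qed

lemma p_power_dvd_binomial: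
  assumes "prime p" "p dvd n choose i"
  shows "p_power_dvd p 1 (of_nat (n choose i))"
proof -
  from assms(2) obtain c where "n choose i = p * c" ..
  then show ?thesis
    using p_power_dvd_power_mult[OF assms(1), of "of_nat c" 1] assms(1) by simp
qed

text \<open>Since \<open>p\<close> divides \<open>p choose Suc j\<close>, Pascal's rule makes
  consecutive entries of row \<open>p - 1\<close> opposite modulo \<open>p\<close>. The signed
  entries therefore all agree with the first one, which is 1.\<close>

lemma alternating_binomial_pred_prime:
  assumes "prime p" "j < p"
  shows "p_power_dvd p 1 ((-1) ^ j * of_nat ((p - 1) choose j) - 1)"
  using assms(2)
proof (induction j)
  case 0
  then show ?case
    using assms(1) by simp
next
  case (Suc j)
  have "p dvd p choose Suc j"
    using Suc.prems assms(1) by (intro dvd_choose_prime) auto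
  then have "p_power_dvd p 1 (of_nat (p choose Suc j))"
    by (rule p_power_dvd_binomial[OF assms(1)])
  then have "p_power_dvd p 1 ((-1) ^ Suc j * of_nat (p choose Suc j) + ((-1) ^ j * of_nat ((p - 1) choose j) - 1))"
    using Suc assms(1)
    by (intro p_power_dvd_add p_power_dvd_mult_left) (auto simp: p_integral_power p_integral_minus)
  moreover have "p choose Suc j = (p - 1 choose Suc j) + (p - 1 choose j)"
    using Suc.prems by (cases p) auto
  then have "(-1) ^ Suc j * of_nat (p choose Suc j) + ((-1) ^ j * of_nat ((p - 1) choose j) - 1) =
      (-1) ^ Suc j * of_nat ((p - 1) choose Suc j) - (1 :: rat)"
    by (simp add: algebra_simps)
  ultimately show ?case
    by (simp only:)
qed

lemma alt_binomial_sum_cong_gen_harm: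
  assumes "prime p"
  shows "p_power_dvd p 1 (alt_binomial_sum s (p - 1) - gen_harm s (p - 1))"
proof -
  have "alt_binomial_sum s (p - 1) - gen_harm s (p - 1) =
      (\<Sum>j = 1..p - 1. ((-1) ^ j * of_nat ((p - 1) choose j) - 1) * (1 / of_nat j) ^ s)"
    unfolding alt_binomial_sum_def gen_harm_def sum_subtractf[symmetric]
    by (rule sum.cong) (simp_all add: power_one_over diff_divide_distrib)
  moreover have "p_power_dvd p 1 (((-1) ^ j * of_nat ((p - 1) choose j) - 1) * (1 / of_nat j) ^ s)"
    if "j \<in> {1..p - 1}" for j
    using that prime_gt_1_nat[OF assms]
    by (intro p_power_dvd_mult_right alternating_binomial_pred_prime p_integral_power
          p_integral_inverse_less assms) auto
  ultimately show ?thesis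
    by (simp only: p_power_dvd_sum[OF assms])
qed

section \<open>Wolstenholme's theorem\<close>

context
  fixes p :: nat
  assumes prime: "prime p" and gt_3: "p > 3"
begin

text \<open>Adding the sum to its reversal pairs \<open>j\<close> with \<open>p - j\<close>, and
  \<open>1/j + 1/(p - j) = p / (j * (p - j))\<close>.\<close>

lemma gen_harm_1_pred_prime_eq:
  "2 * gen_harm 1 (p - 1) = of_nat p * (\<Sum>j = 1..p - 1. (1 / of_nat j) * (1 / of_nat (p - j)))"
proof -
  have "gen_harm 1 (p - 1) = (\<Sum>j = 1..p - 1. 1 / of_nat (p - j))"
    unfolding gen_harm_def
    using sum.atLeastAtMost_rev[of "\<lambda>j. 1 / of_nat j ^ 1 :: rat" 1 "p - 1"] gt_3 by simp
  then have "2 * gen_harm 1 (p - 1) = (\<Sum>j = 1..p - 1. 1 / of_nat j + 1 / of_nat (p - j))"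
    by (simp add: gen_harm_def sum.distrib)
  also have "\<dots> = (\<Sum>j = 1..p - 1. of_nat p * ((1 / of_nat j) * (1 / of_nat (p - j))))"
    by (rule sum.cong) (auto simp: divide_simps of_nat_diff)
  finally show ?thesis
    by (simp add: sum_distrib_left)
qed

lemma p_power_dvd_halve: "p_power_dvd p r (2 * x) \<Longrightarrow> p_power_dvd p r x"
  using p_power_dvd_mult_left[OF prime p_integral_inverse_less[OF prime, of 2], of r "2 * x"] gt_3
  by simp

lemma p_integral_inverse_pair:
  assumes "j \<in> {1..p - 1}"
  shows "p_integral p (1 / of_nat j)" "p_integral p (1 / of_nat (p - j))"
  using assms gt_3 by (auto intro!: p_integral_inverse_less[OF prime])

lemma gen_harm_1_pred_prime: "p_power_dvd p 1 (gen_harm 1 (p - 1))"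
proof -
  have "p_integral p (\<Sum>j = 1..p - 1. (1 / of_nat j) * (1 / of_nat (p - j)))"
    using p_integral_inverse_pair by (intro p_integral_sum[OF prime] p_integral_mult[OF prime])
  then show ?thesis
    using p_power_dvd_power_mult[OF prime, of _ 1] gen_harm_1_pred_prime_eq p_power_dvd_halve by simp
qed

text \<open>The two evaluations of \<open>alt_binomial_sum 2 (p - 1)\<close>, as \<open>H\<^sub>2\<close> modulo \<open>p\<close> and as
  \<open>- (H\<^sub>1\<^sup>2 + H\<^sub>2) / 2\<close>, give \<open>3 H\<^sub>2 \<equiv> 0\<close>.\<close>
lemma gen_harm_2_pred_prime: "p_power_dvd p 1 (gen_harm 2 (p - 1))"
proof -
  let ?d = "alt_binomial_sum 2 (p - 1) - gen_harm 2 (p - 1)"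
  have "3 * gen_harm 2 (p - 1) = - (gen_harm 1 (p - 1) * gen_harm 1 (p - 1)) - 2 * ?d"
    using alt_binomial_sum_2[of "p - 1"] by (simp add: power2_eq_square)
  moreover have "p_power_dvd p 1 (- (gen_harm 1 (p - 1) * gen_harm 1 (p - 1)) - 2 * ?d)"
    using p_integral_gen_harm[OF prime] gen_harm_1_pred_prime gt_3
    by (intro p_power_dvd_diff p_power_dvd_minus p_power_dvd_mult_left
          alt_binomial_sum_cong_gen_harm prime) (auto simp: prime)
  ultimately have "p_power_dvd p 1 (3 * gen_harm 2 (p - 1))"
    by simp
  then show ?thesis
    using p_power_dvd_mult_left[OF prime p_integral_inverse_less[OF prime, of 3]] gt_3 by fastforce
qed

lemma alt_binomial_sum_2_pred_prime: "p_power_dvd p 1 (alt_binomial_sum 2 (p - 1))"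
  using p_power_dvd_add[OF prime alt_binomial_sum_cong_gen_harm[OF prime, of 2] gen_harm_2_pred_prime]
  by simp

text \<open>The pairing identity already supplies one factor \<open>p\<close>. The second comes from
  its cofactor \<open>?W\<close>, which is congruent to \<open>- gen_harm 2 (p - 1)\<close> modulo
  \<open>p\<close>.\<close>

lemma wolstenholme: "p_power_dvd p 2 (gen_harm 1 (p - 1))"
proof -
  let ?W = "\<Sum>j = 1..p - 1. (1 / of_nat j) * (1 / of_nat (p - j)) :: rat"
  let ?V = "\<Sum>j = 1..p - 1. (1 / of_nat j) ^ 2 * (1 / of_nat (p - j)) :: rat"
  \<comment> \<open>This is the exact form of \<open>1/(p - j)\<close> being congruent to
    \<open>- 1/j\<close> modulo \<open>p\<close>.\<close>
  have "?W = (\<Sum>j = 1..p - 1. of_nat p * ((1 / of_nat j) ^ 2 * (1 / of_nat (p - j))) - 1 / of_nat j ^ 2)"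
    by (rule sum.cong) (auto simp: divide_simps of_nat_diff power2_eq_square)
  then have W: "?W = of_nat p ^ 1 * ?V - gen_harm 2 (p - 1)"
    by (simp add: sum_subtractf sum_distrib_left gen_harm_def)
  have "p_integral p ?V"
    using p_integral_inverse_pair
    by (intro p_integral_sum[OF prime] p_integral_mult[OF prime] p_integral_power[OF prime])
  then have "p_power_dvd p 1 ?W"
    unfolding W by (intro p_power_dvd_diff p_power_dvd_power_mult gen_harm_2_pred_prime prime)
  then have "p_power_dvd p (1 + 1) (of_nat p * ?W)"
    using p_power_dvd_power_mult[OF prime, of 1 1] prime by (intro p_power_dvd_mult) auto
  then show ?thesis
    using gen_harm_1_pred_prime_eq p_power_dvd_halve by (simp add: numeral_2_eq_2)
qed

section \<open>Congruences modulo p^5 for a single factor and a single summand\<close>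

text \<open>This is the \<open>t\<close> of the overview; \<open>coeff_2\<close> and
  \<open>coeff_3\<close> are its \<open>a\<close> and \<open>b\<close>.\<close>

definition shift :: rat where
  "shift = of_nat p / (of_nat p + 1)"

text \<open>Chosen so that the two sides of \<open>factor_cong\<close> agree exactly in degrees 2 and 3 in \<open>u\<close>.\<close>
definition coeff_2 :: rat where
  "coeff_2 = of_nat p ^ 2 * shift / 2"

definition coeff_3 :: rat where
  "coeff_3 = of_nat p * coeff_2 + of_nat p ^ 2 * (1 - of_nat p) * shift ^ 2 / 6"

lemma p_power_dvd_shift: "p_power_dvd p 1 shift"
proof -
  have "\<not> p dvd p + 1"
    using gt_3 dvd_add_right_iff[of p p 1] by simp
  then have "p_integral p (1 / of_nat (p + 1))"
    by (rule p_integral_inverse_of_nat[OF prime])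
  then show ?thesis
    using p_power_dvd_power_mult[OF prime, of "1 / of_nat (p + 1)" 1]
    by (simp add: shift_def add.commute)
qed

lemma p_power_dvd_p_power: "p_power_dvd p r (of_nat p ^ r)"
  using p_power_dvd_power_mult[OF prime, of 1 r] prime by simp

lemma p_power_dvd_coeff_2: "p_power_dvd p 3 coeff_2"
proof -
  have "p_power_dvd p (2 + 1) (of_nat p ^ 2 * shift)"
    by (intro p_power_dvd_mult p_power_dvd_shift p_power_dvd_p_power prime)
  then show ?thesis
    using p_power_dvd_halve[of 3 coeff_2] by (simp add: coeff_2_def)
qed

lemma p_power_dvd_coeff_3: "p_power_dvd p 4 coeff_3"
proof -
  have "\<not> p dvd 6"
  proof
    assume "p dvd 6"
    then have "p dvd 2 * 3"
      by simp
    then have "p dvd 2 \<or> p dvd 3"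
      using prime prime_dvd_mult_iff by blast
    then show False
      using gt_3 by (auto dest: dvd_imp_le)
  qed
  then have "p_integral p (1 / of_nat 6)"
    by (rule p_integral_inverse_of_nat[OF prime])
  moreover have "p_power_dvd p (2 + 2) (of_nat p ^ 2 * shift ^ 2)"
    by (intro p_power_dvd_mult p_power_dvd_power p_power_dvd_shift p_power_dvd_p_power prime)
  then have "p_power_dvd p 4 (of_nat p ^ 2 * shift ^ 2)"
    by simp
  ultimately have "p_power_dvd p 4 ((1 - of_nat p) * (1 / of_nat 6) * (of_nat p ^ 2 * shift ^ 2))"
    using prime by (simp only: p_power_dvd_mult_left p_integral_mult p_integral_diff p_integral_of_nat p_integral_numeral)
  moreover have "p_power_dvd p (1 + 3) (of_nat p ^ 1 * coeff_2)"
    by (intro p_power_dvd_mult p_power_dvd_coeff_2 p_power_dvd_p_power prime)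
  ultimately have "p_power_dvd p 4 (of_nat p ^ 1 * coeff_2 + (1 - of_nat p) * (1 / of_nat 6) * (of_nat p ^ 2 * shift ^ 2))"
    by (intro p_power_dvd_add prime) auto
  then show ?thesis
    by (simp add: coeff_3_def mult_ac)
qed

text \<open>The binomial expansion is compared with the product degree by degree. Up to degree 3
  they agree; the product's remaining term \<open>p * coeff_3 * u ^ 4\<close> (up to sign) and the
  expansion from degree 4 on are divisible by \<open>p ^ 5\<close>.\<close>

lemma factor_cong:
  assumes u: "p_integral p u"
  shows "p_power_dvd p 5 ((1 - shift * u) ^ (p + 1) -
    (1 - of_nat p * u) * (1 + coeff_2 * u ^ 2 + coeff_3 * u ^ 3))"
proof -
  let ?q = "of_nat p :: rat"
  let ?c = "\<lambda>i. of_nat (p + 1 choose i) * (- shift * u) ^ i"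
  have "?q + 1 > 0"
    by (simp add: add_nonneg_pos)
  then have tq: "(?q + 1) * shift = ?q"
    by (simp add: shift_def)
  have choose_2_3: "of_nat (p + 1 choose 2) = (?q + 1) * ?q / 2"
      "of_nat (p + 1 choose 3) = (?q + 1) * ?q * (?q - 1) / 6"
    unfolding binomial_gbinomial by (simp_all add: gbinomial_prod_rev numeral_eq_Suc)
  have tu: "p_power_dvd p 1 (- shift * u)"
    using p_power_dvd_mult_right[OF prime p_power_dvd_minus[OF prime p_power_dvd_shift] u] .
  have high: "p_power_dvd p 5 (?c i)" if "i \<ge> 4" for i
  proof (cases "i = 4")
    case True
    have "p choose 4 = p choose Suc 3" "p + 1 choose 4 = (p choose 3) + (p choose Suc 3)"
      by (simp_all add: numeral_eq_Suc)
    \<comment> \<open>Together with \<open>p > 3\<close> this gives \<open>4 < p\<close>, so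
      \<open>p\<close> divides both Pascal summands of \<open>p + 1 choose 4\<close>. That is the
      fifth factor \<open>p\<close>, since \<open>shift ^ 4\<close> gives only four.\<close>
    moreover have "p \<noteq> 4"
      using prime by auto
    then have "p dvd p choose 3" "p dvd p choose 4"
      using gt_3 prime by (auto intro!: dvd_choose_prime)
    ultimately have "p dvd p + 1 choose 4"
      by simp
    then have "p_power_dvd p (1 + 4) (?c 4)"
      by (intro p_power_dvd_mult p_power_dvd_power p_power_dvd_binomial prime tu)
    then show ?thesis
      using True by simp
  next
    case False
    then have "p_power_dvd p 5 ((- shift * u) ^ i)"
      using p_power_dvd_mono[OF prime p_power_dvd_power[OF prime tu], of 5 i] that by simp
    then show ?thesis
      using prime by (intro p_power_dvd_mult_left) auto
  qed
  have "(1 - shift * u) ^ (p + 1) = (- shift * u + 1) ^ (p + 1)"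
    by simp
  also have "\<dots> = (\<Sum>i\<le>p + 1. ?c i)"
    unfolding binomial_ring by simp
  also have "\<dots> = (\<Sum>i\<le>3. ?c i) + (\<Sum>i = 4..p + 1. ?c i)"
  proof -
    have "{..p + 1} = {..3} \<union> {4..p + 1}"
      using gt_3 by auto
    then show ?thesis
      by (simp only:) (rule sum.union_disjoint; auto)
  qed
  also have "(\<Sum>i\<le>3. ?c i) = ?c 0 + ?c 1 + ?c 2 + ?c 3"
    by (simp add: numeral_eq_Suc)
  also have "\<dots> = 1 - (?q + 1) * shift * u + (?q + 1) * shift * ?q * shift / 2 * u ^ 2 -
        (?q + 1) * shift * ?q * (?q - 1) * shift ^ 2 / 6 * u ^ 3"
    unfolding choose_2_3 by (simp add: power2_eq_square power3_eq_cube field_simps)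
  \<comment> \<open>After \<open>tq\<close>, the coefficients of degree 2 and 3 on the left are
    \<open>coeff_2\<close> and \<open>coeff_3 - p * coeff_2\<close>.\<close>
  also have "\<dots> = (1 - ?q * u) * (1 + coeff_2 * u ^ 2 + coeff_3 * u ^ 3) + ?q ^ 1 * coeff_3 * u ^ 4"
    unfolding tq coeff_3_def coeff_2_def by (simp add: field_simps power2_eq_square power3_eq_cube power4_eq_xxxx)
  finally have *: "(1 - shift * u) ^ (p + 1) - (1 - ?q * u) * (1 + coeff_2 * u ^ 2 + coeff_3 * u ^ 3) =
      ?q ^ 1 * coeff_3 * u ^ 4 + (\<Sum>i = 4..p + 1. ?c i)"
    by simp
  have "p_power_dvd p (1 + 4) (?q ^ 1 * coeff_3)"
    by (intro p_power_dvd_mult p_power_dvd_coeff_3 p_power_dvd_p_power prime)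
  then have "p_power_dvd p 5 (?q ^ 1 * coeff_3 * u ^ 4)"
    using p_integral_power[OF prime u] p_power_dvd_mult_right[OF prime] by (simp del: power_one_right)
  then show ?thesis
    unfolding * using high by (intro p_power_dvd_add p_power_dvd_sum prime) auto
qed

text \<open>The ratio of consecutive coefficients is \<open>(x - Suc k) / Suc k\<close>. Used with
  \<open>x = shift\<close> for the summands and with \<open>x = p\<close> for row
  \<open>p - 1\<close>, it exposes parallel products.\<close>

lemma gbinomial_Suc_neg:
  "x - 1 gchoose Suc k = - ((x - 1 gchoose k) * (1 - x * (1 / of_nat (Suc k))))" for x :: rat
proof -
  have "of_nat (Suc k) * (x - 1 gchoose Suc k) = (x - 1 gchoose k) * (x - of_nat (Suc k))"
    using gbinomial_mult_1[of "x - 1" k] by (simp add: algebra_simps)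
  then show ?thesis
    by (simp add: field_simps del: of_nat_Suc)
qed

text \<open>Induction multiplies the congruence for \<open>k\<close> by \<open>factor_cong\<close>
  at \<open>u = 1 / Suc k\<close>, which is p-integral because \<open>Suc k < p\<close>. The factor
  \<open>1 - p * u\<close> advances the signed binomial, and the corrections add up modulo
  \<open>p ^ 5\<close>.\<close>

lemma term_cong:
  "k < p \<Longrightarrow> p_power_dvd p 5 ((shift - 1 gchoose k) ^ (p + 1) -
    (-1) ^ k * of_nat (p - 1 choose k) * (1 + coeff_2 * gen_harm 2 k + coeff_3 * gen_harm 3 k))"
proof (induction k)
  case 0
  then show ?case
    using prime by (simp add: gen_harm_def)
next
  case (Suc k)
  let ?u = "1 / of_nat (Suc k) :: rat"
  let ?c = "\<lambda>k. (-1) ^ k * of_nat (p - 1 choose k) :: rat"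
  let ?h = "coeff_2 * gen_harm 2 k + coeff_3 * gen_harm 3 k"
  let ?v = "coeff_2 * ?u ^ 2 + coeff_3 * ?u ^ 3"
  have u: "p_integral p ?u"
    using Suc.prems by (intro p_integral_inverse_less[OF prime]) auto
  \<comment> \<open>The even exponent removes the sign produced by
    \<open>gbinomial_Suc_neg\<close>.\<close>
  have "even (p + 1)"
    using prime gt_3 prime_odd_nat by fastforce
  then have G: "(shift - 1 gchoose Suc k) ^ (p + 1) = (shift - 1 gchoose k) ^ (p + 1) * (1 - shift * ?u) ^ (p + 1)"
    by (simp only: gbinomial_Suc_neg power_minus_even power_mult_distrib)
  have c: "?c (Suc k) = ?c k * (1 - of_nat p * ?u)"
  proof -
    have "of_nat (p - 1) = of_nat p - (1 :: rat)"
      using gt_3 by (simp add: of_nat_diff)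
    then show ?thesis
      unfolding binomial_gbinomial by (simp only: gbinomial_Suc_neg) simp
  qed
  have c_int: "p_integral p (?c j)" for j
    using prime by (auto intro!: p_integral_mult p_integral_power p_integral_minus)
  have a1: "p_power_dvd p 3 (coeff_2 * x + coeff_3 * y)" if "p_integral p x" "p_integral p y" for x y
    using that p_power_dvd_mono[OF prime p_power_dvd_coeff_3, of 3]
    by (intro p_power_dvd_add p_power_dvd_mult_right p_power_dvd_coeff_2 prime) auto
  have h: "p_power_dvd p 3 ?h" and v: "p_power_dvd p 3 ?v"
    using Suc.prems u by (auto intro!: a1 p_integral_gen_harm p_integral_power prime)
  have int: "p_integral p x" if "p_power_dvd p 3 x" for x
    using p_power_dvd_mono[OF prime that, of 0] p_power_dvd_zero_iff[OF prime] by simp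
  \<comment> \<open>Both corrections are divisible by \<open>p ^ 3\<close>, so their product is
    divisible by \<open>p ^ 6\<close> and \<open>(1 + ?h) * (1 + ?v)\<close> may be replaced by
    \<open>1 + (?h + ?v)\<close>.\<close>
  have "p_power_dvd p 5 (?h * ?v)"
    by (rule p_power_dvd_mono[OF prime p_power_dvd_mult[OF prime h v]]) simp
  moreover have "p_integral p (?c k * (1 - of_nat p * ?u))"
    by (rule p_integral_mult[OF prime c_int p_integral_diff[OF prime _ p_integral_mult[OF prime _ u]]])
      (simp_all add: prime)
  ultimately have "p_power_dvd p 5 (?c k * (1 - of_nat p * ?u) * (?h * ?v))"
    by (intro p_power_dvd_mult_left[OF prime, of "?c k * (1 - of_nat p * ?u)" 5 "?h * ?v"])
  moreover have "?c k * (1 + ?h) * ((1 - of_nat p * ?u) * (1 + ?v)) -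
      ?c k * (1 - of_nat p * ?u) * (1 + (?h + ?v)) = ?c k * (1 - of_nat p * ?u) * (?h * ?v)"
    by (simp add: algebra_simps del: of_nat_Suc)
  moreover have "coeff_2 * gen_harm 2 (Suc k) + coeff_3 * gen_harm 3 (Suc k) = ?h + ?v"
    by (simp add: gen_harm_Suc algebra_simps power_one_over del: of_nat_Suc)
  ultimately have "p_power_dvd p 5 (?c k * (1 + ?h) * ((1 - of_nat p * ?u) * (1 + ?v)) -
      ?c (Suc k) * (1 + (coeff_2 * gen_harm 2 (Suc k) + coeff_3 * gen_harm 3 (Suc k))))"
    by (simp only: c)
  moreover have "p_power_dvd p 5 ((shift - 1 gchoose Suc k) ^ (p + 1) -
      ?c k * (1 + ?h) * ((1 - of_nat p * ?u) * (1 + ?v)))"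
    unfolding G
  proof (rule p_power_dvd_diff_mult[OF prime])
    show "p_power_dvd p 5 ((shift - 1 gchoose k) ^ (p + 1) - ?c k * (1 + ?h))"
      using Suc by (simp add: add.assoc)
    show "p_power_dvd p 5 ((1 - shift * ?u) ^ (p + 1) - (1 - of_nat p * ?u) * (1 + ?v))"
      using factor_cong[OF u] by (simp only: add.assoc)
    show "p_integral p (?c k * (1 + ?h))"
      by (rule p_integral_mult[OF prime c_int p_integral_add[OF prime _ int[OF h]]]) (simp add: prime)
    have "p_integral p shift"
      using p_power_dvd_mono[OF prime p_power_dvd_shift, of 0] p_power_dvd_zero_iff[OF prime] by simp
    then show "p_integral p ((1 - shift * ?u) ^ (p + 1))"
      using u prime by (intro p_integral_power p_integral_diff p_integral_mult) auto
  qed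
  ultimately show ?case
    using p_power_dvd_trans_diff[OF prime] by (simp only: add.assoc)
qed

section \<open>Summation over k\<close>

lemma sum_gbinomial_power:
  "p_power_dvd p 5 (\<Sum>k = 0..p - 1. (- 1 / (of_nat p + 1) gchoose k) ^ (p + 1))"
proof -
  let ?c = "\<lambda>k. (-1) ^ k * of_nat (p - 1 choose k) :: rat"
  let ?N = "of_nat (p - 1) :: rat"
  \<comment> \<open>Summation by parts is stated for row \<open>Suc n\<close>; here
    \<open>n = p - 2\<close>.\<close>
  have pred: "p - 1 = Suc (p - 2)"
    using gt_3 by simp
  have "of_nat p + 1 \<noteq> (0 :: rat)"
    by (metis of_nat_Suc add.commute of_nat_eq_0_iff nat.distinct(1))
  then have shift: "- 1 / (of_nat p + 1) = shift - 1"
    by (simp add: shift_def field_simps)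
  have "(\<Sum>k\<le>p - 1. ?c k * (1 + coeff_2 * gen_harm 2 k + coeff_3 * gen_harm 3 k)) =
      (\<Sum>k\<le>p - 1. ?c k) + coeff_2 * (\<Sum>k\<le>p - 1. ?c k * gen_harm (Suc 1) k) +
      coeff_3 * (\<Sum>k\<le>p - 1. ?c k * gen_harm (Suc 2) k)"
    by (simp add: sum.distrib sum_distrib_left algebra_simps numeral_eq_Suc)
  also have "(\<Sum>k\<le>p - 1. ?c k) = 0"
    using gt_3 by (intro choose_alternating_sum) auto
  also have "(\<Sum>k\<le>p - 1. ?c k * gen_harm (Suc 1) k) = - gen_harm 1 (p - 1) / ?N"
    using sum_alt_binomial_gen_harm[of "p - 2" 1] pred alt_binomial_sum_1[of "p - 1"] by simp
  also have "(\<Sum>k\<le>p - 1. ?c k * gen_harm (Suc 2) k) = alt_binomial_sum 2 (p - 1) / ?N"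
    using sum_alt_binomial_gen_harm[of "p - 2" 2] pred by simp
  finally have *: "(\<Sum>k\<le>p - 1. ?c k * (1 + coeff_2 * gen_harm 2 k + coeff_3 * gen_harm 3 k)) =
      (coeff_3 * alt_binomial_sum 2 (p - 1) - coeff_2 * gen_harm 1 (p - 1)) * (1 / ?N)"
    by (simp add: field_simps diff_divide_distrib)
  have "p_power_dvd p (4 + 1) (coeff_3 * alt_binomial_sum 2 (p - 1))"
    "p_power_dvd p (3 + 2) (coeff_2 * gen_harm 1 (p - 1))"
    by (intro p_power_dvd_mult p_power_dvd_coeff_2 p_power_dvd_coeff_3 wolstenholme alt_binomial_sum_2_pred_prime prime)+
  then have "p_power_dvd p 5 (coeff_3 * alt_binomial_sum 2 (p - 1) - coeff_2 * gen_harm 1 (p - 1))"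
    by (intro p_power_dvd_diff prime) auto
  \<comment> \<open>The denominator \<open>p - 1\<close> left by summation by parts lies strictly
    between 0 and \<open>p\<close>, hence is a unit.\<close>
  moreover have "p_integral p (1 / ?N)"
    using gt_3 by (intro p_integral_inverse_less prime) auto
  ultimately have main: "p_power_dvd p 5 (\<Sum>k\<le>p - 1. ?c k * (1 + coeff_2 * gen_harm 2 k + coeff_3 * gen_harm 3 k))"
    unfolding * by (rule p_power_dvd_mult_right[OF prime])
  have "p_power_dvd p 5 (\<Sum>k\<le>p - 1. (shift - 1 gchoose k) ^ (p + 1) -
      ?c k * (1 + coeff_2 * gen_harm 2 k + coeff_3 * gen_harm 3 k))"
    using gt_3 by (intro p_power_dvd_sum prime term_cong) auto
  from p_power_dvd_add[OF prime this main] show ?thesis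
    unfolding shift sum_subtractf by (simp add: atMost_atLeast0)
qed

end

theorem theorem1p1:
  fixes p :: nat
  assumes "prime p" and "p > 3"
  shows "rat_cong_pow p 5
    (\<Sum>k = 0..p - 1. (((- 1 / (of_nat p + 1)) :: rat) gchoose k) ^ (p + 1)) 0"
  \<comment> \<open>Lowering the exponent from 5 to 0 yields the p-integrality of the sum itself
    that \<open>rat_cong_pow\<close> demands.\<close>
  using sum_gbinomial_power[OF assms] p_power_dvd_mono[OF assms(1), of 5 _ 0]
  unfolding rat_cong_pow_def
  by (simp add: p_power_dvd_iff[OF assms(1)] p_integral_numeral[OF assms(1)])

end
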